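(* Let $\mathbf{k}=[k_1\cdots k_M]^\top\in\mathbb{N}^M$ and $\mathbf{l}=[l_1\cdots l_T]^\top\in\mathbb{N}^T$ have positive entries, $K=\sum_{i=1}^M k_i$, $L=\sum_{j=1}^T l_j$, $n_p=\sum_{i=1}^{M}\sum_{j=1}^{T}(k_i+l_j-1)$, and let $P\in\mathbb{R}^{L\times t}$, $b\in\mathbb{R}^{n_p}$ and $v\in[0,+\infty)^{n_p}$. Put $w:=v^{-1}$ (entrywise) and $c:=\mathrm{diag}(v)\,b$. Define $$f^{(LN)}_*(P):=\min_{\widehat c\in\mathbb{R}^{n_p}}\|c-\widehat c\|_w^2\ \text{ subject to }\ \mathscr{H}_{\mathbf{k},\mathbf{l}}(\widehat c)P=0,$$ with optimal solution $\widehat c_*(P)$, and $g^{(LN)}_*(P):=\mathrm{diag}(\sqrt w)\,(c-\widehat c_*(P))$. Define also $$f^{(LS)}_*(P):=\min_{x\in\mathbb{R}^{Kt}}\|\mathcal{A}_{\mathbf{k},\mathbf{l}}(P)x-b\|_v^2,\qquad g^{(LS)}_*(P):=\mathrm{diag}(\sqrt v)\,\big(b-\mathcal{A}_{\mathbf{k},\mathbf{l}}(P)x_*\big),$$ where $x_*$ is a minimizer of the latter problem. Then $$f^{(LS)}_*(P)=\|b\|_v^2-f^{(LN)}_*(P),\qquad g^{(LS)}_*(P)=\mathrm{diag}(\sqrt v)\,b-g^{(LN)}_*(P),\qquad f^{(LS)}_*(P)=\|g^{(LS)}_*(P)\|_2^2 .$$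
   Context: Weighted extended seminorm: for $w\in[0,+\infty]^m$ and $y\in\mathbb{R}^m$, $\|y\|_w^2=\sum_j w_jy_j^2$, with the convention $0\cdot\infty=0$; an infinite weight $w_j=\infty$ in $\|c-\widehat c\|_w^2$ acts as the equality constraint $\widehat c_j=c_j$ (the distance is required to be finite), and the corresponding entry of $\mathrm{diag}(\sqrt w)(c-\widehat c)$ is $0$. The inverse weight $v^{-1}$ is entrywise, with $0^{-1}=+\infty$. Mosaic Hankel matrix: for $c^{(i,j)}\in\mathbb{R}^{k_i+l_j-1}$ and the stacked vector $c=\mathrm{col}(c^{(1,1)},\dots,c^{(1,T)},\dots,c^{(M,1)},\dots,c^{(M,T)})\in\mathbb{R}^{n_p}$, $\mathscr{H}_{\mathbf{k},\mathbf{l}}(c)\in\mathbb{R}^{K\times L}$ is the block matrix whose $(i,j)$ block is the Hankel matrix $\mathscr{H}_{k_i,l_j}(c^{(i,j)})\in\mathbb{R}^{k_i\times l_j}$ with $(a,b)$ entry $c^{(i,j)}_{a+b-1}$. Multiplication matrices: for a vector $h=[h_0\cdots h_r]^\top$ and $m\ge 0$, $\mathbf{M}_m(h)\in\mathbb{R}^{(m+r+1)\times(m+1)}$ is the Toeplitz matrix with $(i,j)$ entry $h_{i-j}$ (zero if $i-j\notin\{0,\dots,r\}$). Partition $P$ into blocks $P^{(i,j)}\in\mathbb{R}^{l_i\times1}$, $i=1,\dots,T$, $j=1,\dots,t$ (so $P=[P^{(i,j)}]$). For $k\ge1$, $\mathcal{A}_{k,\mathbf{l}}(P)$ is the block matrix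 whose $(i,j)$ block is $\mathbf{M}_{k-1}(P^{(i,j)})$, $1\le i\le T$, $1\le j\le t$, and $$\mathcal{A}_{\mathbf{k},\mathbf{l}}(P):=\mathrm{blkdiag}\big(\mathcal{A}_{k_1,\mathbf{l}}(P),\dots,\mathcal{A}_{k_M,\mathbf{l}}(P)\big)\in\mathbb{R}^{n_p\times Kt}.$$ *)

theory Defs
  imports "Jordan_Normal_Form.Matrix" "HOL-Library.Extended_Real"
begin

text \<open>
  Indices start at 0 throughout. The size vectors \<open>k\<close> and \<open>l\<close> are lists of natural
  numbers, so that \<open>M = length ks\<close>, \<open>T = length ls\<close>, \<open>K = sum_list ks\<close> and \<open>L = sum_list ls\<close>.
\<close>

section \<open>Weighted extended seminorm\<close>

text \<open>Multiplication on \<^typ>\<open>ereal\<close> satisfies \<open>0 * \<infinity> = 0\<close>, and \<open>inverse 0 = \<infinity>\<close>.\<close>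

definition wnorm_sq :: "ereal vec \<Rightarrow> real vec \<Rightarrow> ereal" where
  "wnorm_sq w y = (\<Sum>j<dim_vec y. w $ j * ereal ((y $ j)\<^sup>2))"

definition inv_weight :: "real vec \<Rightarrow> ereal vec" where
  "inv_weight v = map_vec (\<lambda>x. inverse (ereal x)) v"

text \<open>
  The vector \<open>diag(sqrt w) y\<close>. An infinite weight acts as the constraint that the entry of \<open>y\<close>
  vanishes, and the entry of the result is then 0.
\<close>

definition diag_sqrt_mult :: "ereal vec \<Rightarrow> real vec \<Rightarrow> real vec" where
  "diag_sqrt_mult w y =
     vec (dim_vec y) (\<lambda>j. if w $ j = \<infinity> then 0 else sqrt (real_of_ereal (w $ j)) * y $ j)"

section \<open>Block matrices\<close>

definition append_cols :: "'a :: zero mat \<Rightarrow> 'a mat \<Rightarrow> 'a mat" where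
  "append_cols A B = four_block_mat A B (0\<^sub>m 0 (dim_col A)) (0\<^sub>m 0 (dim_col B))"

text \<open>
  The grid whose \<open>(i,j)\<close> block is \<open>B i j\<close>, of size \<open>rs ! i\<close> times \<open>cs ! j\<close>. The size lists also fix
  the dimensions when the grid has no rows or no columns.
\<close>

definition block_mat :: "nat list \<Rightarrow> nat list \<Rightarrow> (nat \<Rightarrow> nat \<Rightarrow> 'a :: zero mat) \<Rightarrow> 'a mat" where
  "block_mat rs cs B =
     foldr append_rows
       (map (\<lambda>i. foldr append_cols (map (\<lambda>j. B i j) [0..<length cs]) (0\<^sub>m (rs ! i) 0))
          [0..<length rs])
       (0\<^sub>m 0 (sum_list cs))"

section \<open>Mosaic Hankel matrices\<close>

definition hankel_mat :: "nat \<Rightarrow> nat \<Rightarrow> real vec \<Rightarrow> real mat" where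
  "hankel_mat k l c = mat k l (\<lambda>(a, b). c $ (a + b))"

definition n_par :: "nat list \<Rightarrow> nat list \<Rightarrow> nat" where
  "n_par ks ls = (\<Sum>k\<leftarrow>ks. \<Sum>l\<leftarrow>ls. k + l - 1)"

text \<open>
  The piece \<open>c(i,j)\<close> of \<open>c = col(c(1,1), \<dots>, c(1,T), \<dots>, c(M,1), \<dots>, c(M,T))\<close> starts at position
  \<open>sub_offset ks ls i j\<close>.
\<close>

definition sub_offset :: "nat list \<Rightarrow> nat list \<Rightarrow> nat \<Rightarrow> nat \<Rightarrow> nat" where
  "sub_offset ks ls i j = n_par (take i ks) ls + (\<Sum>l\<leftarrow>take j ls. ks ! i + l - 1)"

definition sub_vec :: "nat list \<Rightarrow> nat list \<Rightarrow> real vec \<Rightarrow> nat \<Rightarrow> nat \<Rightarrow> real vec" where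
  "sub_vec ks ls c i j = vec (ks ! i + ls ! j - 1) (\<lambda>a. c $ (sub_offset ks ls i j + a))"

definition mosaic_hankel :: "nat list \<Rightarrow> nat list \<Rightarrow> real vec \<Rightarrow> real mat" where
  "mosaic_hankel ks ls c =
     block_mat ks ls (\<lambda>i j. hankel_mat (ks ! i) (ls ! j) (sub_vec ks ls c i j))"

section \<open>Multiplication matrices\<close>

text \<open>
  For \<open>h\<close> of dimension \<open>r + 1\<close>, the matrix \<open>M_m(h)\<close> has \<open>m + r + 1 = m + dim_vec h\<close> rows.
\<close>

definition mult_mat :: "nat \<Rightarrow> real vec \<Rightarrow> real mat" where
  "mult_mat m h = mat (m + dim_vec h) (m + 1)
     (\<lambda>(i, j). if j \<le> i \<and> i - j < dim_vec h then h $ (i - j) else 0)"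

definition col_block :: "nat list \<Rightarrow> real mat \<Rightarrow> nat \<Rightarrow> nat \<Rightarrow> real vec" where
  "col_block ls P i j = vec (ls ! i) (\<lambda>r. P $$ (sum_list (take i ls) + r, j))"

definition block_mult_mat :: "nat \<Rightarrow> nat list \<Rightarrow> real mat \<Rightarrow> real mat" where
  "block_mult_mat k ls P =
     block_mat (map (\<lambda>l. k + l - 1) ls) (replicate (dim_col P) k)
       (\<lambda>i j. mult_mat (k - 1) (col_block ls P i j))"

definition mosaic_mult_mat :: "nat list \<Rightarrow> nat list \<Rightarrow> real mat \<Rightarrow> real mat" where
  "mosaic_mult_mat ks ls P = diag_block_mat (map (\<lambda>k. block_mult_mat k ls P) ks)"

section \<open>The least-norm problem\<close>

text \<open>
  Infinite weights impose equality constraints, so the distance is required to be finite.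
\<close>

definition LN_feasible ::
  "nat list \<Rightarrow> nat list \<Rightarrow> ereal vec \<Rightarrow> real vec \<Rightarrow> real mat \<Rightarrow> real vec set" where
  "LN_feasible ks ls w c P =
     {c' \<in> carrier_vec (n_par ks ls).
        mosaic_hankel ks ls c' * P = 0\<^sub>m (sum_list ks) (dim_col P) \<and> wnorm_sq w (c - c') < \<infinity>}"

definition f_LN :: "nat list \<Rightarrow> nat list \<Rightarrow> ereal vec \<Rightarrow> real vec \<Rightarrow> real mat \<Rightarrow> ereal" where
  "f_LN ks ls w c P = (INF c' \<in> LN_feasible ks ls w c P. wnorm_sq w (c - c'))"

definition LN_solution ::
  "nat list \<Rightarrow> nat list \<Rightarrow> ereal vec \<Rightarrow> real vec \<Rightarrow> real mat \<Rightarrow> real vec \<Rightarrow> bool" where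
  "LN_solution ks ls w c P c' \<longleftrightarrow>
     is_arg_min (\<lambda>c'. wnorm_sq w (c - c')) (\<lambda>c'. c' \<in> LN_feasible ks ls w c P) c'"

definition g_LN :: "ereal vec \<Rightarrow> real vec \<Rightarrow> real vec \<Rightarrow> real vec" where
  "g_LN w c c' = diag_sqrt_mult w (c - c')"

section \<open>The least-squares problem\<close>

definition LS_cost ::
  "nat list \<Rightarrow> nat list \<Rightarrow> real vec \<Rightarrow> real vec \<Rightarrow> real mat \<Rightarrow> real vec \<Rightarrow> ereal" where
  "LS_cost ks ls v b P x = wnorm_sq (map_vec ereal v) (mosaic_mult_mat ks ls P *\<^sub>v x - b)"

definition f_LS :: "nat list \<Rightarrow> nat list \<Rightarrow> real vec \<Rightarrow> real vec \<Rightarrow> real mat \<Rightarrow> ereal" where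
  "f_LS ks ls v b P = (INF x \<in> carrier_vec (sum_list ks * dim_col P). LS_cost ks ls v b P x)"

definition LS_solution ::
  "nat list \<Rightarrow> nat list \<Rightarrow> real vec \<Rightarrow> real vec \<Rightarrow> real mat \<Rightarrow> real vec \<Rightarrow> bool" where
  "LS_solution ks ls v b P x \<longleftrightarrow>
     is_arg_min (LS_cost ks ls v b P) (\<lambda>x. x \<in> carrier_vec (sum_list ks * dim_col P)) x"

definition g_LS ::
  "nat list \<Rightarrow> nat list \<Rightarrow> real vec \<Rightarrow> real vec \<Rightarrow> real mat \<Rightarrow> real vec \<Rightarrow> real vec" where
  "g_LS ks ls v b P x =
     mat_diag (dim_vec v) (\<lambda>j. sqrt (v $ j)) *\<^sub>v (b - mosaic_mult_mat ks ls P *\<^sub>v x)"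

end

theory Submission
  imports Defs
begin

text \<open>
  Write \<open>A\<close> for the multiplication matrix of \<open>P\<close> and \<open>V = diag(v)\<close>, so that \<open>c = V b\<close>. Both
  problems are governed by one vector \<open>x0\<close>, a solution of the normal equations
  \<open>A\<^sup>T V (b - A x0) = 0\<close>.

  The link between them is the adjointness of Hankel and multiplication matrices: the entries of
  \<open>\<H>(c') P\<close> are, up to their arrangement, those of \<open>A\<^sup>T c'\<close>. Both are the correlations of the
  pieces of \<open>c'\<close> with the columns of \<open>P\<close>. Hence the constraint of the least-norm problem says
  \<open>A\<^sup>T c' = 0\<close> (\<open>mosaic_hankel_annihilator_iff\<close>), and the normal equations say precisely that
  \<open>c0 = V (b - A x0)\<close> satisfies it. The infinite weights, which sit where \<open>v\<close> vanishes, require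
  \<open>c'\<close> to vanish there as \<open>c\<close> does; \<open>c0\<close> fulfils this as well.

  Since the range of \<open>A\<close> is orthogonal to the kernel of \<open>A\<^sup>T\<close>, the theorem of Pythagoras holds
  in both problems: the least-norm cost of a feasible \<open>c'\<close> is
  \<open>\<parallel>A x0\<parallel>\<^sub>v\<^sup>2 + \<parallel>c' - c0\<parallel>\<^sub>w\<^sup>2\<close> (\<open>least_norm_cost\<close>), and the least-squares cost of \<open>x\<close> is
  \<open>\<parallel>b - A x0\<parallel>\<^sub>v\<^sup>2 + \<parallel>A (x - x0)\<parallel>\<^sub>v\<^sup>2\<close> (\<open>least_squares_cost\<close>). The first formula makes \<open>c0\<close> the
  only minimizer, and the second determines \<open>A x\<close> for a minimizer \<open>x\<close> wherever \<open>v\<close> is positive.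
  So the two minima are \<open>\<parallel>A x0\<parallel>\<^sub>v\<^sup>2\<close> and \<open>\<parallel>b - A x0\<parallel>\<^sub>v\<^sup>2\<close>, which add up to \<open>\<parallel>b\<parallel>\<^sub>v\<^sup>2\<close> by the
  second formula at \<open>x = 0\<close>; the two weighted residuals are \<open>diag(sqrt v) A x0\<close> and
  \<open>diag(sqrt v) (b - A x0)\<close>. The normal equations are always solvable, also for a degenerate
  weight (\<open>normal_equations_solvable\<close>), so both minima are attained.
\<close>

section \<open>Positions in concatenated blocks\<close>

lemma sum_lessThan_add:
  fixes f :: "nat \<Rightarrow> 'a::comm_monoid_add"
  shows "(\<Sum>p<m + n. f p) = (\<Sum>p<m. f p) + (\<Sum>p<n. f (m + p))"
  by (induction n) (simp_all add: add.assoc)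

text \<open>
  Entry \<open>a\<close> of block \<open>i\<close> of a concatenation with block sizes \<open>ns\<close> sits at position
  \<open>sum_list (take i ns) + a\<close>, and every position is of this form exactly once. The sum over
  positions serves for matrix products, the splitting of a position for matrix equality.
\<close>
lemma sum_lessThan_sum_list:
  fixes f :: "nat \<Rightarrow> 'a::comm_monoid_add"
  shows "(\<Sum>p<sum_list ns. f p) =
    (\<Sum>i<length ns. \<Sum>a<ns ! i. f (sum_list (take i ns) + a))"
proof (induction ns arbitrary: f)
  case (Cons n ns)
  have "(\<Sum>p<sum_list (n # ns). f p) = (\<Sum>p<n. f p) + (\<Sum>p<sum_list ns. f (n + p))"
    by (simp add: sum_lessThan_add)
  also have "(\<Sum>p<sum_list ns. f (n + p)) =
    (\<Sum>i<length ns. \<Sum>a<ns ! i. f (n + (sum_list (take i ns) + a)))"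
    by (rule Cons.IH)
  finally show ?case
    by (simp add: sum.lessThan_Suc_shift add.assoc del: sum.lessThan_Suc)
qed simp

lemma sum_list_take_add_less:
  "i < length ns \<Longrightarrow> a < ns ! i \<Longrightarrow> sum_list (take i ns) + a < sum_list ns" for a :: nat
proof (induction ns arbitrary: i)
  case (Cons n ns)
  then show ?case by (cases i) auto
qed simp

lemma less_sum_list_split:
  fixes p :: nat
  assumes "p < sum_list ns"
  obtains i a where "i < length ns" "a < ns ! i" "p = sum_list (take i ns) + a"
proof -
  from assms have "\<exists>i a. i < length ns \<and> a < ns ! i \<and> p = sum_list (take i ns) + a"
  proof (induction ns arbitrary: p)
    case (Cons n ns)
    show ?case
    proof (cases "p < n")
      case True
      then show ?thesis by (intro exI[of _ 0] exI[of _ p]) auto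
    next
      case False
      then have "p - n < sum_list ns" using Cons.prems by auto
      then obtain i a where "i < length ns" "a < ns ! i" "p - n = sum_list (take i ns) + a"
        using Cons.IH by blast
      then show ?thesis using False by (intro exI[of _ "Suc i"] exI[of _ a]) auto
    qed
  qed simp
  then show ?thesis using that by blast
qed

section \<open>Entries of block matrices\<close>

lemma foldr_append_cols:
  assumes "length As = length cs" "\<And>j. j < length cs \<Longrightarrow> As ! j \<in> carrier_mat r (cs ! j)"
  shows "foldr append_cols As (0\<^sub>m r 0) \<in> carrier_mat r (sum_list cs)"
    and "j < length cs \<Longrightarrow> q < cs ! j \<Longrightarrow> a < r \<Longrightarrow>
      foldr append_cols As (0\<^sub>m r 0) $$ (a, sum_list (take j cs) + q) = As ! j $$ (a, q)"
proof -
  have "foldr append_cols As (0\<^sub>m r 0) \<in> carrier_mat r (sum_list cs) \<and>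
    (\<forall>j q a. j < length cs \<longrightarrow> q < cs ! j \<longrightarrow> a < r \<longrightarrow>
      foldr append_cols As (0\<^sub>m r 0) $$ (a, sum_list (take j cs) + q) = As ! j $$ (a, q))"
    using assms
  proof (induction As cs rule: list_induct2)
    case (Cons A As c cs)
    let ?F = "foldr append_cols As (0\<^sub>m r 0)"
    have A: "A \<in> carrier_mat r c" using Cons.prems[of 0] by simp
    have As: "As ! j \<in> carrier_mat r (cs ! j)" if "j < length cs" for j
      using Cons.prems[of "Suc j"] that by simp
    have F: "?F \<in> carrier_mat r (sum_list cs)" and
      Fi: "\<And>j q a. j < length cs \<Longrightarrow> q < cs ! j \<Longrightarrow> a < r \<Longrightarrow>
        ?F $$ (a, sum_list (take j cs) + q) = As ! j $$ (a, q)"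
      using Cons.IH[OF As] by blast+
    have "append_cols A ?F $$ (a, sum_list (take j (c # cs)) + q) = (A # As) ! j $$ (a, q)"
      if "j < length (c # cs)" "q < (c # cs) ! j" "a < r" for j q a
    proof (cases j)
      case 0
      then show ?thesis using that A F by (auto simp: append_cols_def)
    next
      case (Suc i)
      then have "sum_list (take i cs) + q < sum_list cs"
        using that by (intro sum_list_take_add_less) auto
      then show ?thesis using that A F Fi Suc by (auto simp: append_cols_def)
    qed
    moreover have "append_cols A ?F \<in> carrier_mat r (sum_list (c # cs))"
      using A F by (auto simp: append_cols_def)
    ultimately show ?case by simp
  qed auto
  then show "foldr append_cols As (0\<^sub>m r 0) \<in> carrier_mat r (sum_list cs)"
    and "j < length cs \<Longrightarrow> q < cs ! j \<Longrightarrow> a < r \<Longrightarrow>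
      foldr append_cols As (0\<^sub>m r 0) $$ (a, sum_list (take j cs) + q) = As ! j $$ (a, q)"
    by auto
qed

lemma foldr_append_rows:
  assumes "length As = length rs" "\<And>i. i < length rs \<Longrightarrow> As ! i \<in> carrier_mat (rs ! i) n"
  shows "foldr append_rows As (0\<^sub>m 0 n) \<in> carrier_mat (sum_list rs) n"
    and "i < length rs \<Longrightarrow> a < rs ! i \<Longrightarrow> q < n \<Longrightarrow>
      foldr append_rows As (0\<^sub>m 0 n) $$ (sum_list (take i rs) + a, q) = As ! i $$ (a, q)"
proof -
  have "foldr append_rows As (0\<^sub>m 0 n) \<in> carrier_mat (sum_list rs) n \<and>
    (\<forall>i a q. i < length rs \<longrightarrow> a < rs ! i \<longrightarrow> q < n \<longrightarrow>
      foldr append_rows As (0\<^sub>m 0 n) $$ (sum_list (take i rs) + a, q) = As ! i $$ (a, q))"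
    using assms
  proof (induction As rs rule: list_induct2)
    case (Cons A As r rs)
    let ?F = "foldr append_rows As (0\<^sub>m 0 n)"
    have A: "A \<in> carrier_mat r n" using Cons.prems[of 0] by simp
    have As: "As ! i \<in> carrier_mat (rs ! i) n" if "i < length rs" for i
      using Cons.prems[of "Suc i"] that by simp
    have F: "?F \<in> carrier_mat (sum_list rs) n" and
      Fi: "\<And>i a q. i < length rs \<Longrightarrow> a < rs ! i \<Longrightarrow> q < n \<Longrightarrow>
        ?F $$ (sum_list (take i rs) + a, q) = As ! i $$ (a, q)"
      using Cons.IH[OF As] by blast+
    have "append_rows A ?F $$ (sum_list (take i (r # rs)) + a, q) = (A # As) ! i $$ (a, q)"
      if "i < length (r # rs)" "a < (r # rs) ! i" "q < n" for i a q
    proof (cases i)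
      case 0
      then show ?thesis using that A F by (auto simp: append_rows_def)
    next
      case (Suc j)
      then have "sum_list (take j rs) + a < sum_list rs"
        using that by (intro sum_list_take_add_less) auto
      then show ?thesis using that A F Fi Suc by (auto simp: append_rows_def)
    qed
    moreover have "append_rows A ?F \<in> carrier_mat (sum_list (r # rs)) n"
      using A F by (auto simp: append_rows_def)
    ultimately show ?case by simp
  qed auto
  then show "foldr append_rows As (0\<^sub>m 0 n) \<in> carrier_mat (sum_list rs) n"
    and "i < length rs \<Longrightarrow> a < rs ! i \<Longrightarrow> q < n \<Longrightarrow>
      foldr append_rows As (0\<^sub>m 0 n) $$ (sum_list (take i rs) + a, q) = As ! i $$ (a, q)"
    by auto
qed

lemma block_mat_blocks:
  assumes "\<And>i j. i < length rs \<Longrightarrow> j < length cs \<Longrightarrow> B i j \<in> carrier_mat (rs ! i) (cs ! j)"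
  shows block_mat_carrier: "block_mat rs cs B \<in> carrier_mat (sum_list rs) (sum_list cs)"
    and block_mat_index: "i < length rs \<Longrightarrow> j < length cs \<Longrightarrow> a < rs ! i \<Longrightarrow> q < cs ! j \<Longrightarrow>
      block_mat rs cs B $$ (sum_list (take i rs) + a, sum_list (take j cs) + q) = B i j $$ (a, q)"
proof -
  define R where
    "R i = foldr append_cols (map (\<lambda>j. B i j) [0..<length cs]) (0\<^sub>m (rs ! i) 0)" for i
  have R: "R i \<in> carrier_mat (rs ! i) (sum_list cs)" if "i < length rs" for i
    unfolding R_def using that assms by (intro foldr_append_cols) auto
  have Ri: "R i $$ (a, sum_list (take j cs) + q) = B i j $$ (a, q)"
    if "i < length rs" "j < length cs" "a < rs ! i" "q < cs ! j" for i j a q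
    unfolding R_def using that assms by (subst foldr_append_cols(2)) auto
  have eq: "block_mat rs cs B =
      foldr append_rows (map R [0..<length rs]) (0\<^sub>m 0 (sum_list cs))"
    unfolding block_mat_def R_def ..
  show "block_mat rs cs B \<in> carrier_mat (sum_list rs) (sum_list cs)"
    unfolding eq using R by (intro foldr_append_rows) auto
  show "block_mat rs cs B $$ (sum_list (take i rs) + a, sum_list (take j cs) + q) = B i j $$ (a, q)"
    if "i < length rs" "j < length cs" "a < rs ! i" "q < cs ! j"
    unfolding eq using that R Ri
    by (subst foldr_append_rows(2)) (auto simp: sum_list_take_add_less)
qed

lemma diag_block_mat_blocks:
  assumes "length As = length rs" "length cs = length rs"
    "\<And>i. i < length rs \<Longrightarrow> As ! i \<in> carrier_mat (rs ! i) (cs ! i)"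
  shows diag_block_mat_carrier: "diag_block_mat As \<in> carrier_mat (sum_list rs) (sum_list cs)"
    and diag_block_mat_index:
      "i < length rs \<Longrightarrow> j < length rs \<Longrightarrow> a < rs ! i \<Longrightarrow> q < cs ! j \<Longrightarrow>
        diag_block_mat As $$ (sum_list (take i rs) + a, sum_list (take j cs) + q) =
          (if i = j then As ! i $$ (a, q) else 0)"
proof -
  have "diag_block_mat As \<in> carrier_mat (sum_list rs) (sum_list cs) \<and>
    (\<forall>i j a q. i < length rs \<longrightarrow> j < length rs \<longrightarrow> a < rs ! i \<longrightarrow> q < cs ! j \<longrightarrow>
        diag_block_mat As $$ (sum_list (take i rs) + a, sum_list (take j cs) + q) =
          (if i = j then As ! i $$ (a, q) else 0))"
    using assms(1) assms(2)[symmetric] assms(3)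
  proof (induction As rs cs rule: list_induct3)
    case (Cons A As r rs c cs)
    let ?D = "diag_block_mat As"
    have A: "A \<in> carrier_mat r c" using Cons.prems[of 0] by simp
    have As: "As ! i \<in> carrier_mat (rs ! i) (cs ! i)" if "i < length rs" for i
      using Cons.prems[of "Suc i"] that by simp
    have D: "?D \<in> carrier_mat (sum_list rs) (sum_list cs)" and
      Di: "\<And>i j a q. i < length rs \<Longrightarrow> j < length rs \<Longrightarrow> a < rs ! i \<Longrightarrow> q < cs ! j \<Longrightarrow>
        ?D $$ (sum_list (take i rs) + a, sum_list (take j cs) + q) =
          (if i = j then As ! i $$ (a, q) else 0)"
      using Cons.IH[OF As] by blast+
    have eq: "diag_block_mat (A # As) =
        four_block_mat A (0\<^sub>m r (sum_list cs)) (0\<^sub>m (sum_list rs) c) ?D"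
      using A D by (auto simp: Let_def)
    have "diag_block_mat (A # As) $$
          (sum_list (take i (r # rs)) + a, sum_list (take j (c # cs)) + q) =
        (if i = j then (A # As) ! i $$ (a, q) else 0)"
      if "i < length (r # rs)" "j < length (r # rs)" "a < (r # rs) ! i" "q < (c # cs) ! j"
      for i j a q
    proof -
      have "sum_list (take i' rs) + a < sum_list rs" if "i = Suc i'" for i'
        using that \<open>i < length (r # rs)\<close> \<open>a < (r # rs) ! i\<close>
        by (intro sum_list_take_add_less) auto
      moreover have "sum_list (take j' cs) + q < sum_list cs" if "j = Suc j'" for j'
        using that \<open>j < length (r # rs)\<close> \<open>q < (c # cs) ! j\<close> Cons.hyps
        by (intro sum_list_take_add_less) auto
      ultimately show ?thesis
        unfolding eq using that A D Di by (cases i; cases j) auto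
    qed
    moreover have "diag_block_mat (A # As) \<in> carrier_mat (sum_list (r # rs)) (sum_list (c # cs))"
      unfolding eq using A D by auto
    ultimately show ?case by blast
  qed auto
  then show "diag_block_mat As \<in> carrier_mat (sum_list rs) (sum_list cs)"
    and "i < length rs \<Longrightarrow> j < length rs \<Longrightarrow> a < rs ! i \<Longrightarrow> q < cs ! j \<Longrightarrow>
        diag_block_mat As $$ (sum_list (take i rs) + a, sum_list (take j cs) + q) =
          (if i = j then As ! i $$ (a, q) else 0)"
    by auto
qed

section \<open>Adjointness of mosaic Hankel and multiplication matrices\<close>

lemma mosaic_hankel_carrier: "mosaic_hankel ks ls c \<in> carrier_mat (sum_list ks) (sum_list ls)"
  unfolding mosaic_hankel_def by (intro block_mat_carrier) (auto simp: hankel_mat_def)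

lemma mosaic_hankel_index:
  assumes "i < length ks" "j < length ls" "a < ks ! i" "q < ls ! j"
  shows "mosaic_hankel ks ls c $$ (sum_list (take i ks) + a, sum_list (take j ls) + q) =
    c $ (sub_offset ks ls i j + (a + q))"
  unfolding mosaic_hankel_def using assms
  by (subst block_mat_index) (auto simp: hankel_mat_def sub_vec_def)

lemma block_mult_mat_blocks:
  assumes "0 < k" "P \<in> carrier_mat (sum_list ls) t"
  shows block_mult_mat_carrier:
      "block_mult_mat k ls P \<in> carrier_mat (\<Sum>l\<leftarrow>ls. k + l - 1) (t * k)"
    and block_mult_mat_index:
      "j < length ls \<Longrightarrow> p < k + ls ! j - 1 \<Longrightarrow> s < t \<Longrightarrow> a < k \<Longrightarrow>
        block_mult_mat k ls P $$ ((\<Sum>l\<leftarrow>take j ls. k + l - 1) + p, s * k + a) =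
          (if a \<le> p \<and> p - a < ls ! j then P $$ (sum_list (take j ls) + (p - a), s) else 0)"
proof -
  have B: "mult_mat (k - 1) (col_block ls P i j) \<in>
      carrier_mat (map (\<lambda>l. k + l - 1) ls ! i) (replicate (dim_col P) k ! j)"
    if "i < length (map (\<lambda>l. k + l - 1) ls)" "j < length (replicate (dim_col P) k)" for i j
    using assms that by (auto simp: mult_mat_def col_block_def)
  have t: "dim_col P = t" using assms by auto
  show "block_mult_mat k ls P \<in> carrier_mat (\<Sum>l\<leftarrow>ls. k + l - 1) (t * k)"
    using block_mat_carrier[OF B] unfolding block_mult_mat_def t by (simp add: sum_list_replicate)
  assume *: "j < length ls" "p < k + ls ! j - 1" "s < t" "a < k"
  have "block_mult_mat k ls P $$ (sum_list (take j (map (\<lambda>l. k + l - 1) ls)) + p,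
      sum_list (take s (replicate (dim_col P) k)) + a) = mult_mat (k - 1) (col_block ls P j s) $$ (p, a)"
    unfolding block_mult_mat_def using * t by (intro block_mat_index[OF B]) auto
  moreover have "sum_list (take s (replicate (dim_col P) k)) = s * k"
    using * t by (simp add: sum_list_replicate)
  ultimately show "block_mult_mat k ls P $$ ((\<Sum>l\<leftarrow>take j ls. k + l - 1) + p, s * k + a) =
      (if a \<le> p \<and> p - a < ls ! j then P $$ (sum_list (take j ls) + (p - a), s) else 0)"
    using * by (auto simp: take_map mult_mat_def col_block_def)
qed

lemma mosaic_mult_mat_blocks:
  assumes "\<forall>k\<in>set ks. 0 < k" "P \<in> carrier_mat (sum_list ls) t"
  shows mosaic_mult_mat_carrier:
      "mosaic_mult_mat ks ls P \<in> carrier_mat (n_par ks ls) (sum_list ks * t)"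
    and mosaic_mult_mat_index:
      "i < length ks \<Longrightarrow> i' < length ks \<Longrightarrow> p < (\<Sum>l\<leftarrow>ls. ks ! i' + l - 1) \<Longrightarrow>
        q < t * ks ! i \<Longrightarrow>
        mosaic_mult_mat ks ls P $$ (n_par (take i' ks) ls + p, t * sum_list (take i ks) + q) =
          (if i' = i then block_mult_mat (ks ! i) ls P $$ (p, q) else 0)"
proof -
  let ?As = "map (\<lambda>k. block_mult_mat k ls P) ks"
  let ?rs = "map (\<lambda>k. \<Sum>l\<leftarrow>ls. k + l - 1) ks"
  let ?cs = "map (\<lambda>k. t * k) ks"
  have len: "length ?As = length ?rs" "length ?cs = length ?rs" by simp_all
  have car: "?As ! i \<in> carrier_mat (?rs ! i) (?cs ! i)" if "i < length ?rs" for i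
    using assms that block_mult_mat_carrier[of "ks ! i" P ls t] by auto
  show "mosaic_mult_mat ks ls P \<in> carrier_mat (n_par ks ls) (sum_list ks * t)"
    using diag_block_mat_carrier[OF len car]
    unfolding mosaic_mult_mat_def n_par_def by (simp add: sum_list_const_mult mult.commute[of "sum_list ks" t])
  assume *: "i < length ks" "i' < length ks" "p < (\<Sum>l\<leftarrow>ls. ks ! i' + l - 1)" "q < t * ks ! i"
  have "diag_block_mat ?As $$ (sum_list (take i' ?rs) + p, sum_list (take i ?cs) + q) =
      (if i' = i then ?As ! i' $$ (p, q) else 0)"
    using * by (intro diag_block_mat_index[OF len car]) auto
  then show "mosaic_mult_mat ks ls P $$ (n_par (take i' ks) ls + p, t * sum_list (take i ks) + q) =
      (if i' = i then block_mult_mat (ks ! i) ls P $$ (p, q) else 0)"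
    using * unfolding mosaic_mult_mat_def n_par_def
    by (auto simp: take_map sum_list_const_mult)
qed

lemma mosaic_column_bounds:
  fixes a s t :: nat
  assumes i: "i < length ks" and a: "a < ks ! i" and s: "s < t"
  shows "s * ks ! i + a < t * ks ! i"
    and "t * sum_list (take i ks) + (s * ks ! i + a) < sum_list ks * t"
proof -
  have "s * ks ! i + a < Suc s * ks ! i" using a by simp
  also have "\<dots> \<le> t * ks ! i" using s by (intro mult_le_mono1) simp
  finally show *: "s * ks ! i + a < t * ks ! i" .
  show "t * sum_list (take i ks) + (s * ks ! i + a) < sum_list ks * t"
    using sum_list_take_add_less[of i "map (\<lambda>k. t * k) ks" "s * ks ! i + a"] i *
    by (simp add: take_map sum_list_const_mult mult.commute[of "sum_list ks" t])
qed

text \<open>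
  Both sides equal \<open>\<Sum>j. \<Sum>q. c(i,j)\<^sub>a\<^sub>+\<^sub>q P(j,s)\<^sub>q\<close>: a row of a Hankel block is the window of
  \<open>c(i,j)\<close> that starts at \<open>a\<close>, and column \<open>a\<close> of a multiplication block is \<open>P(j,s)\<close>
  shifted down by \<open>a\<close>. On the right, the columns are ordered by block row \<open>i\<close>, then by
  column \<open>s\<close> of \<open>P\<close>, then by shift \<open>a\<close>.
\<close>
lemma mosaic_hankel_mult_index:
  assumes ks: "\<forall>k\<in>set ks. 0 < k" and P: "P \<in> carrier_mat (sum_list ls) t"
    and c: "c \<in> carrier_vec (n_par ks ls)"
    and i: "i < length ks" and a: "a < ks ! i" and s: "s < t"
  shows "(mosaic_hankel ks ls c * P) $$ (sum_list (take i ks) + a, s) =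
    (transpose_mat (mosaic_mult_mat ks ls P) *\<^sub>v c) $ (t * sum_list (take i ks) + (s * ks ! i + a))"
proof -
  define k where "k = ks ! i"
  define A where "A = mosaic_mult_mat ks ls P"
  let ?n = "\<lambda>i. \<Sum>l\<leftarrow>ls. ks ! i + l - 1"
  have k: "0 < k" using ks i unfolding k_def by auto
  have A: "A \<in> carrier_mat (n_par ks ls) (sum_list ks * t)"
    unfolding A_def by (rule mosaic_mult_mat_carrier[OF ks P])
  note sk = mosaic_column_bounds(1)[OF i a s, folded k_def]
  note col = mosaic_column_bounds(2)[OF i a s, folded k_def]
  have block: "block_mult_mat k ls P $$ ((\<Sum>l\<leftarrow>take j ls. k + l - 1) + p, s * k + a) =
      (if a \<le> p \<and> p - a < ls ! j then P $$ (sum_list (take j ls) + (p - a), s) else 0)"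
    if "j < length ls" "p < k + ls ! j - 1" for j p
    using block_mult_mat_index[OF k P that s] a unfolding k_def by blast
  have row: "sum_list (take i ks) + a < sum_list ks"
    using i a by (rule sum_list_take_add_less)
  have "(mosaic_hankel ks ls c * P) $$ (sum_list (take i ks) + a, s) =
      (\<Sum>p<sum_list ls. mosaic_hankel ks ls c $$ (sum_list (take i ks) + a, p) * P $$ (p, s))"
    using mosaic_hankel_carrier[of ks ls c] P row s
    by (simp add: scalar_prod_def atLeast0LessThan)
  also have "\<dots> = (\<Sum>j<length ls. \<Sum>q<ls ! j.
      c $ (sub_offset ks ls i j + (a + q)) * P $$ (sum_list (take j ls) + q, s))"
    unfolding sum_lessThan_sum_list using i a by (simp add: mosaic_hankel_index)
  also have "\<dots> = (\<Sum>j<length ls. \<Sum>p<k + ls ! j - 1.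
      (if a \<le> p \<and> p - a < ls ! j then P $$ (sum_list (take j ls) + (p - a), s) else 0) *
        c $ (sub_offset ks ls i j + p))"
  proof (rule sum.cong[OF refl])
    fix j
    \<comment> \<open>Substituting \<open>p = a + q\<close> turns the window of \<open>c\<close> into the shift of the column of \<open>P\<close>.\<close>
    have "(\<Sum>q<ls ! j. c $ (sub_offset ks ls i j + (a + q)) * P $$ (sum_list (take j ls) + q, s)) =
        (\<Sum>p\<in>{a..<a + ls ! j}. P $$ (sum_list (take j ls) + (p - a), s) * c $ (sub_offset ks ls i j + p))"
      by (intro sum.reindex_bij_witness[of _ "\<lambda>p. p - a" "\<lambda>q. a + q"]) auto
    also have "\<dots> = (\<Sum>p<k + ls ! j - 1.
      (if a \<le> p \<and> p - a < ls ! j then P $$ (sum_list (take j ls) + (p - a), s) else 0) *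
        c $ (sub_offset ks ls i j + p))"
      using a by (intro sum.mono_neutral_cong_left) (auto simp: k_def)
    finally show "(\<Sum>q<ls ! j. c $ (sub_offset ks ls i j + (a + q)) * P $$ (sum_list (take j ls) + q, s)) =
      (\<Sum>p<k + ls ! j - 1.
      (if a \<le> p \<and> p - a < ls ! j then P $$ (sum_list (take j ls) + (p - a), s) else 0) *
        c $ (sub_offset ks ls i j + p))" .
  qed
  also have "\<dots> = (\<Sum>j<length (map (\<lambda>l. k + l - 1) ls). \<Sum>p<map (\<lambda>l. k + l - 1) ls ! j.
      block_mult_mat k ls P $$ (sum_list (take j (map (\<lambda>l. k + l - 1) ls)) + p, s * k + a) *
        c $ (n_par (take i ks) ls + (sum_list (take j (map (\<lambda>l. k + l - 1) ls)) + p)))"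
    by (intro sum.cong)
      (simp_all add: block take_map sub_offset_def add.assoc k_def[symmetric] del: One_nat_def)
  also have "\<dots> = (\<Sum>p<?n i. block_mult_mat k ls P $$ (p, s * k + a) * c $ (n_par (take i ks) ls + p))"
    unfolding k_def by (rule sum_lessThan_sum_list[symmetric])
  \<comment> \<open>The block rows \<open>i' \<noteq> i\<close> of the block diagonal matrix contribute zeros.\<close>
  also have "\<dots> = (\<Sum>i'<length ks. if i' = i then
      (\<Sum>p<?n i'. block_mult_mat k ls P $$ (p, s * k + a) * c $ (n_par (take i' ks) ls + p)) else 0)"
    using i by (simp add: sum.delta)
  also have "\<dots> = (\<Sum>i'<length (map (\<lambda>k. \<Sum>l\<leftarrow>ls. k + l - 1) ks).
      \<Sum>p<map (\<lambda>k. \<Sum>l\<leftarrow>ls. k + l - 1) ks ! i'.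
        A $$ (sum_list (take i' (map (\<lambda>k. \<Sum>l\<leftarrow>ls. k + l - 1) ks)) + p,
          t * sum_list (take i ks) + (s * k + a)) *
        c $ (sum_list (take i' (map (\<lambda>k. \<Sum>l\<leftarrow>ls. k + l - 1) ks)) + p))"
  proof (intro sum.cong)
    fix i' assume "i' \<in> {..<length (map (\<lambda>k. \<Sum>l\<leftarrow>ls. k + l - 1) ks)}"
    then have i': "i' < length ks" by simp
    have "A $$ (n_par (take i' ks) ls + p, t * sum_list (take i ks) + (s * k + a)) =
        (if i' = i then block_mult_mat k ls P $$ (p, s * k + a) else 0)" if "p < ?n i'" for p
      using mosaic_mult_mat_index[OF ks P i i' that, of "s * k + a"] sk
      unfolding A_def k_def by simp
    then show "(if i' = i then
        (\<Sum>p<?n i'. block_mult_mat k ls P $$ (p, s * k + a) * c $ (n_par (take i' ks) ls + p)) else 0) =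
      (\<Sum>p<map (\<lambda>k. \<Sum>l\<leftarrow>ls. k + l - 1) ks ! i'.
        A $$ (sum_list (take i' (map (\<lambda>k. \<Sum>l\<leftarrow>ls. k + l - 1) ks)) + p,
          t * sum_list (take i ks) + (s * k + a)) *
        c $ (sum_list (take i' (map (\<lambda>k. \<Sum>l\<leftarrow>ls. k + l - 1) ks)) + p))"
      using i' by (simp add: take_map del: One_nat_def flip: n_par_def)
  qed simp
  also have "\<dots> = (\<Sum>r<n_par ks ls. A $$ (r, t * sum_list (take i ks) + (s * k + a)) * c $ r)"
    unfolding n_par_def by (rule sum_lessThan_sum_list[symmetric])
  also have "\<dots> = (transpose_mat A *\<^sub>v c) $ (t * sum_list (take i ks) + (s * k + a))"
    using A c col by (simp add: scalar_prod_def atLeast0LessThan)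
  finally show ?thesis unfolding A_def k_def .
qed

lemma mosaic_hankel_annihilator_iff:
  assumes ks: "\<forall>k\<in>set ks. 0 < k" and P: "P \<in> carrier_mat (sum_list ls) t"
    and c: "c \<in> carrier_vec (n_par ks ls)"
  shows "mosaic_hankel ks ls c * P = 0\<^sub>m (sum_list ks) t \<longleftrightarrow>
    transpose_mat (mosaic_mult_mat ks ls P) *\<^sub>v c = 0\<^sub>v (sum_list ks * t)"
    (is "?H = _ \<longleftrightarrow> ?y = _")
proof
  have y: "?y \<in> carrier_vec (sum_list ks * t)"
    using mosaic_mult_mat_carrier[OF ks P] c by auto
  note entry = mosaic_hankel_mult_index[OF ks P c]
  show "?y = 0\<^sub>v (sum_list ks * t)" if H: "?H = 0\<^sub>m (sum_list ks) t"
  proof (rule eq_vecI)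
    fix p assume "p < dim_vec (0\<^sub>v (sum_list ks * t))"
    then have "p < sum_list (map (\<lambda>k. t * k) ks)"
      by (simp add: sum_list_const_mult mult.commute[of t "sum_list ks"])
    then obtain i q where i: "i < length ks" and q: "q < t * ks ! i"
      and p: "p = t * sum_list (take i ks) + q"
      by (rule less_sum_list_split) (auto simp: take_map sum_list_const_mult)
    have "0 < ks ! i" using ks i by auto
    moreover have "q div ks ! i < t" using q by (simp add: less_mult_imp_div_less)
    moreover have "sum_list (take i ks) + q mod ks ! i < sum_list ks"
      using i \<open>0 < ks ! i\<close> by (intro sum_list_take_add_less) auto
    ultimately have "?y $ p = 0"
      using entry[of i "q mod ks ! i" "q div ks ! i"] i H p by (simp add: div_mult_mod_eq)
    then show "?y $ p = 0\<^sub>v (sum_list ks * t) $ p"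
      using \<open>p < dim_vec _\<close> by simp
  qed (use y in \<open>auto dest: carrier_vecD\<close>)
  show "?H = 0\<^sub>m (sum_list ks) t" if Y: "?y = 0\<^sub>v (sum_list ks * t)"
  proof (rule eq_matI)
    fix p s assume "p < dim_row (0\<^sub>m (sum_list ks) t)" "s < dim_col (0\<^sub>m (sum_list ks) t)"
    then have p: "p < sum_list ks" and s: "s < t" by auto
    from p obtain i a where i: "i < length ks" and a: "a < ks ! i"
      and p': "p = sum_list (take i ks) + a"
      by (rule less_sum_list_split)
    have "t * sum_list (take i ks) + (s * ks ! i + a) < sum_list ks * t"
      by (rule mosaic_column_bounds(2)[OF i a s])
    then show "?H $$ (p, s) = 0\<^sub>m (sum_list ks) t $$ (p, s)"
      using entry[OF i a s] Y p s unfolding p' by simp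
  qed (use mosaic_hankel_carrier[of ks ls c] P in auto)
qed

section \<open>Weighted seminorms in real terms\<close>

lemma sum_nonpos_imp_term_eq_0:
  fixes f :: "nat \<Rightarrow> real"
  assumes "(\<Sum>j<n. f j) \<le> 0" "\<And>j. j < n \<Longrightarrow> 0 \<le> f j" "j < n"
  shows "f j = 0"
proof -
  have "(\<Sum>j<n. f j) = 0"
    using assms(1,2) by (intro antisym sum_nonneg) auto
  then show ?thesis
    using assms(2,3) by (subst (asm) sum_nonneg_eq_0_iff) auto
qed

lemma wnorm_sq_real:
  assumes "dim_vec v = dim_vec y"
  shows "wnorm_sq (map_vec ereal v) y = ereal (\<Sum>j<dim_vec y. v $ j * (y $ j)\<^sup>2)"
  unfolding wnorm_sq_def using assms by simp

text \<open>
  An infinite weight times 0 is 0, and so is the real quotient \<open>0 / 0\<close>; hence the seminorm is the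
  plain real sum of quotients as soon as it is finite.
\<close>
lemma wnorm_sq_inv_weight:
  assumes v: "v \<in> carrier_vec n" "\<forall>j<n. 0 \<le> v $ j" and y: "y \<in> carrier_vec n"
  shows wnorm_sq_inv_weight_finite_iff:
      "wnorm_sq (inv_weight v) y < \<infinity> \<longleftrightarrow> (\<forall>j<n. v $ j = 0 \<longrightarrow> y $ j = 0)"
    and wnorm_sq_inv_weight_real:
      "(\<forall>j<n. v $ j = 0 \<longrightarrow> y $ j = 0) \<Longrightarrow>
        wnorm_sq (inv_weight v) y = ereal (\<Sum>j<n. (y $ j)\<^sup>2 / v $ j)"
proof -
  let ?s = "\<lambda>j. inv_weight v $ j * ereal ((y $ j)\<^sup>2)"
  have sum: "wnorm_sq (inv_weight v) y = (\<Sum>j<n. ?s j)"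
    unfolding wnorm_sq_def using y by simp
  have summand: "?s j = (if v $ j = 0 \<and> y $ j \<noteq> 0 then \<infinity> else ereal ((y $ j)\<^sup>2 / v $ j))"
    if "j < n" for j
    using that v by (auto simp: inv_weight_def divide_inverse mult.commute)
  show *: "wnorm_sq (inv_weight v) y = ereal (\<Sum>j<n. (y $ j)\<^sup>2 / v $ j)"
    if "\<forall>j<n. v $ j = 0 \<longrightarrow> y $ j = 0"
  proof -
    have "(\<Sum>j<n. ?s j) = (\<Sum>j<n. ereal ((y $ j)\<^sup>2 / v $ j))"
      using that summand by (intro sum.cong) auto
    then show ?thesis unfolding sum by simp
  qed
  have "wnorm_sq (inv_weight v) y = \<infinity>" if "j < n" "v $ j = 0" "y $ j \<noteq> 0" for j
    unfolding sum using that summand by (intro iffD2[OF sum_Pinfty]) auto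
  then show "wnorm_sq (inv_weight v) y < \<infinity> \<longleftrightarrow> (\<forall>j<n. v $ j = 0 \<longrightarrow> y $ j = 0)"
    using * by (cases "\<forall>j<n. v $ j = 0 \<longrightarrow> y $ j = 0") auto
qed

lemma mat_diag_mult_vec:
  fixes f :: "nat \<Rightarrow> 'a::semiring_1"
  assumes "y \<in> carrier_vec n"
  shows "mat_diag n f *\<^sub>v y = vec n (\<lambda>j. f j * y $ j)"
proof (rule eq_vecI)
  fix i assume "i < dim_vec (vec n (\<lambda>j. f j * y $ j))"
  then have i: "i < n" by simp
  have "(mat_diag n f *\<^sub>v y) $ i = (\<Sum>j<n. (if i = j then f j else 0) * y $ j)"
    using i assms by (simp add: mat_diag_def scalar_prod_def atLeast0LessThan)
  also have "\<dots> = (\<Sum>j<n. if i = j then f j * y $ j else 0)"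
    by (intro sum.cong) auto
  finally show "(mat_diag n f *\<^sub>v y) $ i = vec n (\<lambda>j. f j * y $ j) $ i"
    using i by simp
qed (simp add: mat_diag_def)

section \<open>Solvability of the weighted normal equations\<close>

text \<open>
  Gram-Schmidt by induction on the number of columns \<open>a r\<close>. By the induction hypothesis, applied
  to \<open>b\<close> and to the new column, both split into a combination of the earlier columns and a
  remainder, \<open>\<rho>\<close> and \<open>q\<close>, orthogonal to them. Subtracting from \<open>\<rho>\<close> its projection
  onto \<open>q\<close> keeps it orthogonal to the earlier columns and makes it orthogonal to the new one.
  Weights may vanish, so the form is only semidefinite, and \<open>q\<close> may have length 0 without being 0.
\<close>
lemma normal_equations_solvable_fun:
  fixes v b :: "nat \<Rightarrow> real" and a :: "nat \<Rightarrow> nat \<Rightarrow> real"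
  assumes "\<And>j. j < n \<Longrightarrow> 0 \<le> v j"
  shows "\<exists>x. \<forall>s<m. (\<Sum>j<n. v j * a s j * (b j - (\<Sum>r<m. x r * a r j))) = 0"
proof (induction m arbitrary: b)
  case (Suc m)
  define ip where "ip f g = (\<Sum>j<n. v j * f j * g j)" for f g
  obtain x where x: "\<And>s. s < m \<Longrightarrow> ip (a s) (\<lambda>j. b j - (\<Sum>r<m. x r * a r j)) = 0"
    using Suc.IH[of b] unfolding ip_def by blast
  obtain y where y: "\<And>s. s < m \<Longrightarrow> ip (a s) (\<lambda>j. a m j - (\<Sum>r<m. y r * a r j)) = 0"
    using Suc.IH[of "a m"] unfolding ip_def by blast
  define \<rho> where "\<rho> j = b j - (\<Sum>r<m. x r * a r j)" for j
  define q where "q j = a m j - (\<Sum>r<m. y r * a r j)" for j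
  define \<mu> where "\<mu> = ip q \<rho> / ip q q"
  have \<rho>: "ip (a s) \<rho> = 0" and q: "ip (a s) q = 0" if "s < m" for s
    using x[OF that] y[OF that] unfolding \<rho>_def q_def by auto
  have diff: "ip f (\<lambda>j. g j - \<mu> * h j) = ip f g - \<mu> * ip f h" for f g h
    unfolding ip_def by (simp add: algebra_simps sum_subtractf sum_distrib_left)
  \<comment> \<open>A null vector of the semidefinite form is orthogonal to every vector, so the value \<open>\<mu> = 0\<close>
    that division by zero gives in this case is a correct coefficient.\<close>
  have null: "ip q \<rho> = 0" if "ip q q = 0"
  proof -
    have "v j * q j * q j = 0" if "j < n" for j
      using \<open>ip q q = 0\<close> assms that unfolding ip_def
      by (subst (asm) sum_nonneg_eq_0_iff) (auto simp: mult.assoc)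
    then show ?thesis unfolding ip_def by (intro sum.neutral) auto
  qed
  have "ip q (\<lambda>j. \<rho> j - \<mu> * q j) = 0"
    unfolding diff using null by (auto simp: \<mu>_def)
  moreover have orth: "ip (a s) (\<lambda>j. \<rho> j - \<mu> * q j) = 0" if "s < m" for s
    unfolding diff using \<rho> q that by simp
  moreover have "ip (a m) h = ip q h + (\<Sum>r<m. y r * ip (a r) h)" for h
  proof -
    have "(\<Sum>r<m. y r * ip (a r) h) = (\<Sum>j<n. v j * (\<Sum>r<m. y r * a r j) * h j)"
      unfolding ip_def sum_distrib_left sum_distrib_right
      by (subst sum.swap) (simp add: mult_ac)
    then show ?thesis
      unfolding q_def by (simp add: ip_def algebra_simps flip: sum.distrib)
  qed
  ultimately have am: "ip (a m) (\<lambda>j. \<rho> j - \<mu> * q j) = 0"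
    by simp
  define z where "z r = (if r = m then \<mu> else x r - \<mu> * y r)" for r
  have "b j - (\<Sum>r<Suc m. z r * a r j) = \<rho> j - \<mu> * q j" for j
    by (simp add: z_def \<rho>_def q_def algebra_simps sum_subtractf sum_distrib_left)
  then have "\<forall>s<Suc m. (\<Sum>j<n. v j * a s j * (b j - (\<Sum>r<Suc m. z r * a r j))) = 0"
    using orth am unfolding ip_def less_Suc_eq by auto
  then show ?case by blast
qed simp

lemma normal_equations_solvable:
  fixes A :: "real mat"
  assumes A: "A \<in> carrier_mat n m" and v: "\<forall>j<n. 0 \<le> v $ j" and b: "b \<in> carrier_vec n"
  obtains x where "x \<in> carrier_vec m"
    "transpose_mat A *\<^sub>v vec n (\<lambda>j. v $ j * (b - A *\<^sub>v x) $ j) = 0\<^sub>v m"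
proof -
  obtain x where x: "\<And>s. s < m \<Longrightarrow>
      (\<Sum>j<n. v $ j * A $$ (j, s) * (b $ j - (\<Sum>r<m. x r * A $$ (j, r)))) = 0"
    using normal_equations_solvable_fun[of n "\<lambda>j. v $ j" m "\<lambda>s j. A $$ (j, s)" "\<lambda>j. b $ j"] v
    by blast
  have Ax: "(A *\<^sub>v vec m x) $ j = (\<Sum>r<m. x r * A $$ (j, r))" if "j < n" for j
    using A that by (simp add: scalar_prod_def atLeast0LessThan mult.commute)
  have "transpose_mat A *\<^sub>v vec n (\<lambda>j. v $ j * (b - A *\<^sub>v vec m x) $ j) = 0\<^sub>v m" (is "?l = _")
  proof (rule eq_vecI)
    fix s assume "s < dim_vec (0\<^sub>v m :: real vec)"
    then have s: "s < m" by simp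
    have "?l $ s = (\<Sum>j<n. A $$ (j, s) * (v $ j * (b - A *\<^sub>v vec m x) $ j))"
      using A s by (simp add: scalar_prod_def atLeast0LessThan)
    also have "\<dots> = (\<Sum>j<n. v $ j * A $$ (j, s) * (b $ j - (\<Sum>r<m. x r * A $$ (j, r))))"
      using A b by (intro sum.cong) (auto simp: Ax simp del: index_mult_mat_vec)
    finally show "?l $ s = 0\<^sub>v m $ s" using x s by simp
  qed (use A in simp)
  then show thesis using that[of "vec m x"] by simp
qed

section \<open>Pythagoras in the least-squares and least-norm problems\<close>

lemma range_orthogonal_kernel_transpose:
  fixes A :: "real mat"
  assumes "A \<in> carrier_mat n m" "x \<in> carrier_vec m" "y \<in> carrier_vec n"
    "transpose_mat A *\<^sub>v y = 0\<^sub>v m"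
  shows "(\<Sum>j<n. (A *\<^sub>v x) $ j * y $ j) = 0"
proof -
  have "y \<bullet> (A *\<^sub>v x) = 0"
    using transpose_vec_mult_scalar[OF assms(1,2,3)] assms(2,4) by simp
  then show ?thesis
    using assms(1) by (simp add: scalar_prod_def atLeast0LessThan mult.commute)
qed

text \<open>
  \<open>A x - b = A (x - x0) - (b - A x0)\<close>, and the mixed term of the square vanishes since the
  normal equations put \<open>V (b - A x0)\<close> into the kernel of \<open>A\<^sup>T\<close>.
\<close>
lemma least_squares_cost:
  fixes A :: "real mat"
  assumes A: "A \<in> carrier_mat n m" and v: "v \<in> carrier_vec n" and b: "b \<in> carrier_vec n"
    and x0: "x0 \<in> carrier_vec m"
      "transpose_mat A *\<^sub>v vec n (\<lambda>j. v $ j * (b - A *\<^sub>v x0) $ j) = 0\<^sub>v m"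
    and x: "x \<in> carrier_vec m"
  shows "wnorm_sq (map_vec ereal v) (A *\<^sub>v x - b) =
    ereal ((\<Sum>j<n. v $ j * ((b - A *\<^sub>v x0) $ j)\<^sup>2) +
      (\<Sum>j<n. v $ j * ((A *\<^sub>v x) $ j - (A *\<^sub>v x0) $ j)\<^sup>2))"
proof -
  let ?r = "vec n (\<lambda>j. v $ j * (b - A *\<^sub>v x0) $ j)"
  have orth: "(\<Sum>j<n. (A *\<^sub>v z) $ j * ?r $ j) = 0" if "z \<in> carrier_vec m" for z
    using A x0 that by (intro range_orthogonal_kernel_transpose) auto
  have "(\<Sum>j<n. v $ j * ((A *\<^sub>v x - b) $ j)\<^sup>2) =
      (\<Sum>j<n. v $ j * ((b - A *\<^sub>v x0) $ j)\<^sup>2 +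
        v $ j * ((A *\<^sub>v x) $ j - (A *\<^sub>v x0) $ j)\<^sup>2 -
        2 * ((A *\<^sub>v x) $ j * ?r $ j) + 2 * ((A *\<^sub>v x0) $ j * ?r $ j))"
    using A b by (intro sum.cong) (auto simp del: index_mult_mat_vec simp: power2_eq_square algebra_simps)
  also have "\<dots> = (\<Sum>j<n. v $ j * ((b - A *\<^sub>v x0) $ j)\<^sup>2) +
      (\<Sum>j<n. v $ j * ((A *\<^sub>v x) $ j - (A *\<^sub>v x0) $ j)\<^sup>2)"
    unfolding sum.distrib sum_subtractf
    using orth[OF x] orth[OF x0(1)] by (simp add: sum_distrib_left[symmetric] del: index_mult_mat_vec index_vec)
  finally show ?thesis
    using v b by (subst wnorm_sq_real) auto
qed

text \<open>
  Here \<open>c - c' = V A x0 - (c' - c0)\<close>. The inverse weight cancels \<open>V\<close> in the mixed term, which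
  becomes the inner product of \<open>A x0\<close> with \<open>c' - c0\<close> and vanishes because \<open>A\<^sup>T\<close> annihilates both
  \<open>c'\<close> and \<open>c0\<close>. The cancellation fails where \<open>v\<close> is 0, but there \<open>c\<close>, \<open>c'\<close> and \<open>c0\<close> are all 0.
\<close>
lemma least_norm_cost:
  fixes A :: "real mat"
  assumes A: "A \<in> carrier_mat n m" and v: "v \<in> carrier_vec n" "\<forall>j<n. 0 \<le> v $ j"
    and b: "b \<in> carrier_vec n" and x0: "x0 \<in> carrier_vec m"
    and c0_def: "c0 = vec n (\<lambda>j. v $ j * (b - A *\<^sub>v x0) $ j)"
    and c0: "transpose_mat A *\<^sub>v c0 = 0\<^sub>v m"
    and c_def: "c = vec n (\<lambda>j. v $ j * b $ j)"
    and c': "c' \<in> carrier_vec n" "transpose_mat A *\<^sub>v c' = 0\<^sub>v m"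
      "\<forall>j<n. v $ j = 0 \<longrightarrow> c' $ j = 0"
  shows "wnorm_sq (inv_weight v) (c - c') =
    ereal ((\<Sum>j<n. v $ j * ((A *\<^sub>v x0) $ j)\<^sup>2) + (\<Sum>j<n. (c' $ j - c0 $ j)\<^sup>2 / v $ j))"
proof -
  let ?e = "\<lambda>j. (A *\<^sub>v x0) $ j"
  have orth: "(\<Sum>j<n. ?e j * c0 $ j) = 0" "(\<Sum>j<n. ?e j * c' $ j) = 0"
    using A x0 c0 c' unfolding c0_def by (intro range_orthogonal_kernel_transpose[OF A x0]; simp)+
  have "((c - c') $ j)\<^sup>2 / v $ j =
      v $ j * (?e j)\<^sup>2 + (c' $ j - c0 $ j)\<^sup>2 / v $ j - 2 * (?e j * c' $ j) + 2 * (?e j * c0 $ j)"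
    if j: "j < n" for j
  proof (cases "v $ j = 0")
    case True
    then show ?thesis using j c' by (simp add: c_def c0_def)
  next
    case False
    have 1: "(c - c') $ j = v $ j * b $ j - c' $ j" and 2: "c0 $ j = v $ j * (b $ j - ?e j)"
      using j c' A b by (simp_all add: c_def c0_def)
    show ?thesis unfolding 1 2 using False
      by (simp add: field_simps power2_eq_square)
  qed
  then have "(\<Sum>j<n. ((c - c') $ j)\<^sup>2 / v $ j) = (\<Sum>j<n. v $ j * (?e j)\<^sup>2 +
      (c' $ j - c0 $ j)\<^sup>2 / v $ j - 2 * (?e j * c' $ j) + 2 * (?e j * c0 $ j))"
    by (intro sum.cong) auto
  also have "\<dots> = (\<Sum>j<n. v $ j * (?e j)\<^sup>2) + (\<Sum>j<n. (c' $ j - c0 $ j)\<^sup>2 / v $ j)"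
    unfolding sum.distrib sum_subtractf
    using orth by (simp add: sum_distrib_left[symmetric] del: index_mult_mat_vec index_vec)
  finally show ?thesis
    using v c' by (subst wnorm_sq_inv_weight_real[of v n]) (auto simp: c_def)
qed

section \<open>Duality of the two problems\<close>

theorem proposition6p5:
  fixes ks ls :: "nat list" and t :: nat and P :: "real mat"
    and b v c :: "real vec" and w :: "ereal vec"
  assumes "\<forall>k\<in>set ks. k > 0" and "\<forall>l\<in>set ls. l > 0"
    and "P \<in> carrier_mat (sum_list ls) t"
    and "b \<in> carrier_vec (n_par ks ls)"
    and "v \<in> carrier_vec (n_par ks ls)"
    and "\<forall>j<n_par ks ls. 0 \<le> v $ j"
    and "w = inv_weight v"
    and "c = mat_diag (n_par ks ls) (\<lambda>j. v $ j) *\<^sub>v b"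
  shows "(\<exists>c'. LN_solution ks ls w c P c') \<and>
    (\<exists>x. LS_solution ks ls v b P x) \<and>
    f_LS ks ls v b P = wnorm_sq (map_vec ereal v) b - f_LN ks ls w c P \<and>
    (\<forall>c' x. LN_solution ks ls w c P c' \<longrightarrow> LS_solution ks ls v b P x \<longrightarrow>
       g_LS ks ls v b P x =
         mat_diag (n_par ks ls) (\<lambda>j. sqrt (v $ j)) *\<^sub>v b - g_LN w c c' \<and>
       f_LS ks ls v b P = ereal (g_LS ks ls v b P x \<bullet> g_LS ks ls v b P x))"
proof -
  note P = assms(3) and b = assms(4) and v = assms(5) and v_nonneg = assms(6) and w = assms(7)
  define n where "n = n_par ks ls"
  define m where "m = sum_list ks * t"
  define A where "A = mosaic_mult_mat ks ls P"
  note [simp del] = index_mult_mat_vec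
  have n: "b \<in> carrier_vec n" "v \<in> carrier_vec n" "\<forall>j<n. 0 \<le> v $ j"
    using b v v_nonneg unfolding n_def by auto
  have t: "dim_col P = t" using P by auto
  have A: "A \<in> carrier_mat n m"
    unfolding A_def n_def m_def by (rule mosaic_mult_mat_carrier[OF assms(1) P])
  have Ax: "A *\<^sub>v x \<in> carrier_vec n" for x using A by (auto intro!: carrier_vecI)
  have diff: "(b - A *\<^sub>v x) $ j = b $ j - (A *\<^sub>v x) $ j" if "j < n" for x j
    using that A by simp
  have c: "c = vec n (\<lambda>j. v $ j * b $ j)"
    unfolding assms(8) n_def using b by (rule mat_diag_mult_vec)
  obtain x0 where x0: "x0 \<in> carrier_vec m"
    and normal: "transpose_mat A *\<^sub>v vec n (\<lambda>j. v $ j * (b - A *\<^sub>v x0) $ j) = 0\<^sub>v m"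
    by (rule normal_equations_solvable[OF A n(3,1)])
  define e where "e j = (A *\<^sub>v x0) $ j" for j
  define c0 where "c0 = vec n (\<lambda>j. v $ j * (b - A *\<^sub>v x0) $ j)"
  have c0_index: "c0 $ j = v $ j * (b $ j - e j)" if "j < n" for j
    using that unfolding c0_def e_def by (simp add: diff)
  define \<alpha> where "\<alpha> = (\<Sum>j<n. v $ j * (e j)\<^sup>2)"
  define \<beta> where "\<beta> = (\<Sum>j<n. v $ j * (b $ j - e j)\<^sup>2)"

  \<comment> \<open>The least-norm problem: \<open>c0\<close> is its only minimizer.\<close>
  have feasible: "c' \<in> LN_feasible ks ls w c P \<longleftrightarrow> c' \<in> carrier_vec n \<and>
      transpose_mat A *\<^sub>v c' = 0\<^sub>v m \<and> (\<forall>j<n. v $ j = 0 \<longrightarrow> c' $ j = 0)" for c'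
  proof (cases "c' \<in> carrier_vec n")
    case True
    have "wnorm_sq w (c - c') < \<infinity> \<longleftrightarrow> (\<forall>j<n. v $ j = 0 \<longrightarrow> (c - c') $ j = 0)"
      unfolding w using n True by (intro wnorm_sq_inv_weight_finite_iff) (auto simp: c)
    also have "\<dots> \<longleftrightarrow> (\<forall>j<n. v $ j = 0 \<longrightarrow> c' $ j = 0)"
      using True by (auto simp: c)
    finally show ?thesis
      using True mosaic_hankel_annihilator_iff[OF assms(1) P, of c']
      unfolding LN_feasible_def t A_def m_def n_def by simp
  qed (simp add: LN_feasible_def n_def)
  have LN_cost: "wnorm_sq w (c - c') = ereal (\<alpha> + (\<Sum>j<n. (c' $ j - c0 $ j)\<^sup>2 / v $ j))"
    if "c' \<in> LN_feasible ks ls w c P" for c'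
    unfolding w \<alpha>_def e_def
    using that n normal unfolding feasible
    by (intro least_norm_cost[OF A n(2,3,1) x0 c0_def _ c]) (auto simp: c0_def)
  have c0_feasible: "c0 \<in> LN_feasible ks ls w c P"
    using normal unfolding feasible c0_def by auto
  have LN_cost0: "wnorm_sq w (c - c0) = ereal \<alpha>"
    using LN_cost[OF c0_feasible] by simp
  have LN_lower: "ereal \<alpha> \<le> wnorm_sq w (c - c')" if "c' \<in> LN_feasible ks ls w c P" for c'
    unfolding LN_cost[OF that] using n by (auto intro!: sum_nonneg divide_nonneg_nonneg)
  have LN_exists: "LN_solution ks ls w c P c0"
    unfolding LN_solution_def is_arg_min_linorder
    using c0_feasible LN_lower LN_cost0 by auto
  have f_LN: "f_LN ks ls w c P = ereal \<alpha>"
    unfolding f_LN_def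
    using LN_lower LN_cost0 by (intro antisym INF_greatest INF_lower2[OF c0_feasible]) auto
  have LN_unique: "c' = c0" if "LN_solution ks ls w c P c'" for c'
  proof -
    have feas: "c' \<in> LN_feasible ks ls w c P" and le: "wnorm_sq w (c - c') \<le> ereal \<alpha>"
      using that c0_feasible LN_cost0 unfolding LN_solution_def is_arg_min_linorder by auto
    have "(\<Sum>j<n. (c' $ j - c0 $ j)\<^sup>2 / v $ j) \<le> 0"
      using le LN_cost[OF feas] by simp
    moreover have "0 \<le> (c' $ j - c0 $ j)\<^sup>2 / v $ j" if "j < n" for j
      using that n by simp
    ultimately have "(c' $ j - c0 $ j)\<^sup>2 / v $ j = 0" if "j < n" for j
      using that by (rule sum_nonpos_imp_term_eq_0)
    then have "c' $ j = c0 $ j" if "j < n" for j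
      using that feas c0_feasible unfolding feasible by (cases "v $ j = 0") auto
    then show ?thesis
      using feas c0_feasible unfolding feasible by (intro eq_vecI) auto
  qed

  \<comment> \<open>The least-squares problem: a minimizer \<open>x\<close> need not be unique, but \<open>A x\<close> agrees with
    \<open>A x0\<close> wherever the weight is positive.\<close>
  have LS_cost: "LS_cost ks ls v b P x =
      ereal (\<beta> + (\<Sum>j<n. v $ j * ((A *\<^sub>v x) $ j - e j)\<^sup>2))" if "x \<in> carrier_vec m" for x
  proof -
    have "(\<Sum>j<n. v $ j * ((b - A *\<^sub>v x0) $ j)\<^sup>2) = \<beta>"
      unfolding \<beta>_def e_def by (simp add: diff)
    then show ?thesis
      using least_squares_cost[OF A n(2,1) x0 normal that]
      unfolding LS_cost_def e_def A_def by simp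
  qed
  have LS_cost0: "LS_cost ks ls v b P x0 = ereal \<beta>"
    using LS_cost[OF x0] by (simp add: e_def)
  have LS_lower: "ereal \<beta> \<le> LS_cost ks ls v b P x" if "x \<in> carrier_vec m" for x
    unfolding LS_cost[OF that] using n by (auto intro!: sum_nonneg)
  have LS_exists: "LS_solution ks ls v b P x0"
    unfolding LS_solution_def is_arg_min_linorder t m_def[symmetric]
    using x0 LS_lower LS_cost0 by auto
  have f_LS: "f_LS ks ls v b P = ereal \<beta>"
    unfolding f_LS_def t m_def[symmetric]
    using LS_lower LS_cost0 by (intro antisym INF_greatest INF_lower2[OF x0]) auto
  have LS_unique: "v $ j = 0 \<or> (A *\<^sub>v x) $ j = e j"
    if "LS_solution ks ls v b P x" "j < n" for x j
  proof -
    have x: "x \<in> carrier_vec m" and le: "LS_cost ks ls v b P x \<le> ereal \<beta>"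
      using that x0 LS_cost0 unfolding LS_solution_def is_arg_min_linorder t m_def by auto
    have "(\<Sum>j<n. v $ j * ((A *\<^sub>v x) $ j - e j)\<^sup>2) \<le> 0"
      using le LS_cost[OF x] by simp
    moreover have "0 \<le> v $ j * ((A *\<^sub>v x) $ j - e j)\<^sup>2" if "j < n" for j
      using that n by simp
    ultimately have "v $ j * ((A *\<^sub>v x) $ j - e j)\<^sup>2 = 0"
      using \<open>j < n\<close> by (rule sum_nonpos_imp_term_eq_0)
    then show ?thesis by simp
  qed

  \<comment> \<open>The Pythagoras formula for the least-squares cost at \<open>x = 0\<close>.\<close>
  have "wnorm_sq (map_vec ereal v) b = LS_cost ks ls v b P (0\<^sub>v m)"
    using n A by (simp add: LS_cost_def A_def[symmetric] wnorm_sq_def index_mult_mat_vec)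
  also have "\<dots> = ereal (\<alpha> + \<beta>)"
    using LS_cost[of "0\<^sub>v m"] A
    by (simp add: \<alpha>_def index_mult_mat_vec add.commute)
  finally have "wnorm_sq (map_vec ereal v) b = ereal (\<alpha> + \<beta>)" .
  then have optimal_values: "f_LS ks ls v b P = wnorm_sq (map_vec ereal v) b - f_LN ks ls w c P"
    unfolding f_LS f_LN by simp

  have g_LS: "g_LS ks ls v b P x = vec n (\<lambda>j. sqrt (v $ j) * (b $ j - e j))"
    if "LS_solution ks ls v b P x" for x
  proof -
    have "g_LS ks ls v b P x = vec n (\<lambda>j. sqrt (v $ j) * (b - A *\<^sub>v x) $ j)"
      unfolding g_LS_def A_def[symmetric] using n Ax[of x] by (simp add: mat_diag_mult_vec)
    also have "\<dots> = vec n (\<lambda>j. sqrt (v $ j) * (b $ j - e j))"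
      using LS_unique[OF that] by (intro eq_vecI) (auto simp: diff)
    finally show ?thesis .
  qed
  have g_LN: "g_LN w c c0 = vec n (\<lambda>j. sqrt (v $ j) * e j)"
  proof (rule eq_vecI)
    fix j assume "j < dim_vec (vec n (\<lambda>j. sqrt (v $ j) * e j))"
    then have j: "j < n" by simp
    have "(c - c0) $ j = v $ j * e j"
      using j c0_index[OF j] by (simp add: c c0_def algebra_simps)
    moreover have "sqrt (1 / v $ j) * (v $ j * e j) = sqrt (v $ j) * e j" if "v $ j \<noteq> 0"
    proof -
      have "0 < v $ j" using that n j by (simp add: less_le)
      then have "sqrt (1 / v $ j) * v $ j = sqrt (v $ j)"
        by (simp add: real_sqrt_divide real_div_sqrt)
      then show ?thesis by (simp only: mult.assoc[symmetric])
    qed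
    ultimately show "g_LN w c c0 $ j = vec n (\<lambda>j. sqrt (v $ j) * e j) $ j"
      unfolding g_LN_def diag_sqrt_mult_def w inv_weight_def
      using j n by (simp add: c0_def inverse_eq_divide)
  qed (simp add: g_LN_def diag_sqrt_mult_def c0_def)
  have residual: "g_LS ks ls v b P x =
        mat_diag (n_par ks ls) (\<lambda>j. sqrt (v $ j)) *\<^sub>v b - g_LN w c c'"
    if "LN_solution ks ls w c P c'" "LS_solution ks ls v b P x" for c' x
    unfolding LN_unique[OF that(1)] g_LS[OF that(2)] g_LN n_def[symmetric]
    using n by (intro eq_vecI) (auto simp: mat_diag_mult_vec algebra_simps)
  have norm: "f_LS ks ls v b P = ereal (g_LS ks ls v b P x \<bullet> g_LS ks ls v b P x)"
    if "LS_solution ks ls v b P x" for x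
  proof -
    have "sqrt (v $ j) * (b $ j - e j) * (sqrt (v $ j) * (b $ j - e j)) = v $ j * (b $ j - e j)\<^sup>2"
      if "j < n" for j
    proof -
      have "sqrt (v $ j) * sqrt (v $ j) = v $ j" using that n by simp
      moreover have "sqrt (v $ j) * (b $ j - e j) * (sqrt (v $ j) * (b $ j - e j)) =
          sqrt (v $ j) * sqrt (v $ j) * (b $ j - e j)\<^sup>2"
        by (simp only: power2_eq_square mult_ac)
      ultimately show ?thesis by (simp only:)
    qed
    then show ?thesis
      unfolding f_LS g_LS[OF that] \<beta>_def by (simp add: scalar_prod_def atLeast0LessThan)
  qed
  show ?thesis
    using LN_exists LS_exists optimal_values residual norm by blast
qed

end
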